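(* Let $\varphi\in S(\mathbb{D})$ and $g\in H(\mathbb{D})$. (1) $C_\varphi J_g-J_gC_\varphi$ is bounded from $H^\infty(\mathbb{D})$ to $\mathcal{B}$ if and only if $$\sup_{z\in\mathbb{D}}(1-|z|^2)\,|(g\circ\varphi)'(z)-g'(z)|<\infty.\qquad( * )$$ (2) $C_\varphi J_g-J_gC_\varphi$ is compact from $H^\infty(\mathbb{D})$ to $\mathcal{B}$ if and only if $( * )$ holds and $$\lim_{|\varphi(z)|\to1}(1-|z|^2)\,|(g\circ\varphi)'(z)-g'(z)|=0.$$
   Context: $\mathbb{D}$ is the open unit disk in $\mathbb{C}$, $H(\mathbb{D})$ is the set of holomorphic functions on $\mathbb{D}$, $H^\infty(\mathbb{D})$ the bounded ones with the supremum norm, and $S(\mathbb{D})$ is the set of holomorphic maps $\mathbb{D}\to\mathbb{D}$. For $\varphi\in S(\mathbb{D})$, $C_\varphi f=f\circ\varphi$. For $g,f\in H(\mathbb{D})$, $J_gf(z)=\int_0^z f(\zeta)g'(\zeta)\,d\zeta$. The Bloch space $\mathcal{B}$ is the set of $f\in H(\mathbb{D})$ with $\|f\|_*=\sup_{z\in\mathbb{D}}(1-|z|^2)|f'(z)|<\infty$, a Banach space with norm $|f(0)|+\|f\|_*$. The notation $\lim_{|\varphi(z)|\to1}F(z)=0$ means: for every $\varepsilon>0$ there is $r\in(0,1)$ such that $|F(z)|<\varepsilon$ whenever $z\in\mathbb{D}$ and $|\varphi(z)|>r$ (vacuously true if $\sup_{\mathbb{D}}|\varphi|<1$). *)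

theory Defs
  imports "HOL-Complex_Analysis.Complex_Analysis"
begin

abbreviation disk :: "complex set" where
  "disk \<equiv> ball 0 1"

text \<open>A function on the disk is represented by its extension by zero to all of the complex plane.
  Then equality of functions is equality on the disk, and the spaces below are
  closed under the pointwise operations.\<close>

definition hol_disk :: "(complex \<Rightarrow> complex) set" where
  "hol_disk = {f. f holomorphic_on disk \<and> (\<forall>z. z \<notin> disk \<longrightarrow> f z = 0)}"

definition hinf :: "(complex \<Rightarrow> complex) set" where
  "hinf = {f \<in> hol_disk. bounded (f ` disk)}"

definition hinf_norm :: "(complex \<Rightarrow> complex) \<Rightarrow> real" where
  "hinf_norm f = (SUP z\<in>disk. cmod (f z))"

definition bloch :: "(complex \<Rightarrow> complex) set" where
  "bloch = {f \<in> hol_disk. bdd_above ((\<lambda>z. (1 - (cmod z)\<^sup>2) * cmod (deriv f z)) ` disk)}"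

definition bloch_norm :: "(complex \<Rightarrow> complex) \<Rightarrow> real" where
  "bloch_norm f = cmod (f 0) + (SUP z\<in>disk. (1 - (cmod z)\<^sup>2) * cmod (deriv f z))"

definition comp_op :: "(complex \<Rightarrow> complex) \<Rightarrow> (complex \<Rightarrow> complex) \<Rightarrow> complex \<Rightarrow> complex" where
  "comp_op \<phi> f = (\<lambda>z. if z \<in> disk then f (\<phi> z) else 0)"

definition volterra_op :: "(complex \<Rightarrow> complex) \<Rightarrow> (complex \<Rightarrow> complex) \<Rightarrow> complex \<Rightarrow> complex" where
  "volterra_op g f = (\<lambda>z. if z \<in> disk
     then contour_integral (linepath 0 z) (\<lambda>\<zeta>. f \<zeta> * deriv g \<zeta>) else 0)"

definition commutator_op ::
  "(complex \<Rightarrow> complex) \<Rightarrow> (complex \<Rightarrow> complex) \<Rightarrow> (complex \<Rightarrow> complex) \<Rightarrow> complex \<Rightarrow> complex" where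
  "commutator_op \<phi> g f = comp_op \<phi> (volterra_op g f) - volterra_op g (comp_op \<phi> f)"

text \<open>Boundedness and compactness of a map \<open>T\<close> from a normed space with carrier \<open>X\<close> and norm
  \<open>nX\<close> to one with carrier \<open>Y\<close> and norm \<open>nY\<close>. Both include that \<open>T\<close> maps \<open>X\<close> into \<open>Y\<close>.
  Linearity is not included, as the commutator above is linear by construction.\<close>

definition bounded_operator ::
  "'a set \<Rightarrow> ('a \<Rightarrow> real) \<Rightarrow> 'b set \<Rightarrow> ('b \<Rightarrow> real) \<Rightarrow> ('a \<Rightarrow> 'b) \<Rightarrow> bool" where
  "bounded_operator X nX Y nY T \<longleftrightarrow>
     T ` X \<subseteq> Y \<and> (\<exists>C. \<forall>f\<in>X. nY (T f) \<le> C * nX f)"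

text \<open>The value off the carrier is irrelevant for the topology, but the locale \<open>Metric_space\<close>
  asks for nonnegativity and symmetry everywhere.\<close>

definition norm_dist :: "'b::minus set \<Rightarrow> ('b \<Rightarrow> real) \<Rightarrow> 'b \<Rightarrow> 'b \<Rightarrow> real" where
  "norm_dist Y nY f h = (if f \<in> Y \<and> h \<in> Y then nY (f - h) else 0)"

definition norm_topology :: "'b::minus set \<Rightarrow> ('b \<Rightarrow> real) \<Rightarrow> 'b topology" where
  "norm_topology Y nY = Metric_space.mtopology Y (norm_dist Y nY)"

definition compact_operator ::
  "'a set \<Rightarrow> ('a \<Rightarrow> real) \<Rightarrow> 'b::minus set \<Rightarrow> ('b \<Rightarrow> real) \<Rightarrow> ('a \<Rightarrow> 'b) \<Rightarrow> bool" where
  "compact_operator X nX Y nY T \<longleftrightarrow>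
     T ` X \<subseteq> Y \<and>
     (\<forall>A. A \<subseteq> X \<and> bdd_above (nX ` A) \<longrightarrow>
        compactin (norm_topology Y nY) (norm_topology Y nY closure_of (T ` A)))"

definition vanishes_at_boundary :: "(complex \<Rightarrow> complex) \<Rightarrow> (complex \<Rightarrow> real) \<Rightarrow> bool" where
  "vanishes_at_boundary \<phi> F \<longleftrightarrow>
     (\<forall>\<epsilon>>0. \<exists>r. 0 < r \<and> r < 1 \<and> (\<forall>z\<in>disk. cmod (\<phi> z) > r \<longrightarrow> \<bar>F z\<bar> < \<epsilon>))"

text \<open>The topology used for compactness is a genuine one: the Bloch norm induces a metric.\<close>

lemma weight_nonneg: "z \<in> disk \<Longrightarrow> 0 \<le> (1 - (cmod z)\<^sup>2) * cmod (deriv f z)"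
  by (simp add: power_le_one)

lemma bloch_field_differentiable:
  assumes "f \<in> bloch" "z \<in> disk"
  shows "f field_differentiable at z"
  using assms unfolding bloch_def hol_disk_def
  by (auto intro: holomorphic_on_imp_differentiable_at)

lemma deriv_diff_bloch:
  assumes "f \<in> bloch" "h \<in> bloch" "z \<in> disk"
  shows "deriv (f - h) z = deriv f z - deriv h z"
proof -
  have "deriv (\<lambda>w. f w - h w) z = deriv f z - deriv h z"
    using assms by (intro deriv_diff bloch_field_differentiable)
  thus ?thesis by (simp add: fun_diff_def)
qed

lemma bloch_diff:
  assumes f: "f \<in> bloch" and h: "h \<in> bloch"
  shows "f - h \<in> bloch"
proof -
  obtain A where A: "\<forall>z\<in>disk. (1 - (cmod z)\<^sup>2) * cmod (deriv f z) \<le> A"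
    using f unfolding bloch_def bdd_above_def by auto
  obtain B where B: "\<forall>z\<in>disk. (1 - (cmod z)\<^sup>2) * cmod (deriv h z) \<le> B"
    using h unfolding bloch_def bdd_above_def by auto
  have "(1 - (cmod z)\<^sup>2) * cmod (deriv (f - h) z) \<le> A + B" if z: "z \<in> disk" for z
  proof -
    have "(1 - (cmod z)\<^sup>2) * cmod (deriv (f - h) z)
        \<le> (1 - (cmod z)\<^sup>2) * (cmod (deriv f z) + cmod (deriv h z))"
      unfolding deriv_diff_bloch[OF f h z] using z
      by (intro mult_left_mono norm_triangle_ineq4) (simp add: power_le_one)
    thus ?thesis using bspec[OF A z] bspec[OF B z] by (simp add: distrib_left)
  qed
  hence "bdd_above ((\<lambda>z. (1 - (cmod z)\<^sup>2) * cmod (deriv (f - h) z)) ` disk)"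
    by (intro bdd_aboveI2) auto
  moreover have "f - h \<in> hol_disk"
    using f h unfolding bloch_def hol_disk_def
    by (auto simp: fun_diff_def intro!: holomorphic_intros)
  ultimately show ?thesis unfolding bloch_def by auto
qed

lemma bloch_seminorm_upper:
  assumes "f \<in> bloch" "z \<in> disk"
  shows "(1 - (cmod z)\<^sup>2) * cmod (deriv f z) \<le> (SUP z\<in>disk. (1 - (cmod z)\<^sup>2) * cmod (deriv f z))"
  using assms unfolding bloch_def by (intro cSUP_upper) auto

lemma bloch_seminorm_nonneg:
  assumes "f \<in> bloch"
  shows "0 \<le> (SUP z\<in>disk. (1 - (cmod z)\<^sup>2) * cmod (deriv f z))"
  using order_trans[OF weight_nonneg bloch_seminorm_upper[OF assms], of 0] by simp

lemma bloch_norm_eq_0: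
  assumes f: "f \<in> bloch" and 0: "bloch_norm f = 0"
  shows "f = (\<lambda>_. 0)"
proof -
  have f0: "f 0 = 0" and s: "(SUP z\<in>disk. (1 - (cmod z)\<^sup>2) * cmod (deriv f z)) = 0"
    using 0 bloch_seminorm_nonneg[OF f] norm_ge_zero[of "f 0"]
    unfolding bloch_norm_def
    by (metis add_nonneg_eq_0_iff norm_eq_zero)+
  have d: "deriv f z = 0" if z: "z \<in> disk" for z
  proof -
    have "(cmod z)\<^sup>2 < 1" using z by (simp add: power_less_one_iff)
    moreover have "(1 - (cmod z)\<^sup>2) * cmod (deriv f z) \<le> 0"
      using bloch_seminorm_upper[OF f z] s by simp
    ultimately show ?thesis by (simp add: mult_le_0_iff)
  qed
  have "(f has_field_derivative 0) (at z within disk)" if "z \<in> disk" for z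
    using bloch_field_differentiable[OF f that] d[OF that]
    by (metis DERIV_deriv_iff_field_differentiable has_field_derivative_at_within)
  hence "\<exists>c. \<forall>z\<in>disk. f z = c"
    by (intro has_field_derivative_zero_constant) auto
  hence "f z = 0" if "z \<in> disk" for z using f0 that by force
  thus ?thesis using f unfolding bloch_def hol_disk_def by fastforce
qed

lemma bloch_norm_triangle:
  assumes f: "f \<in> bloch" and h: "h \<in> bloch"
  shows "bloch_norm (f - h) \<le> bloch_norm f + bloch_norm h"
proof -
  let ?S = "\<lambda>f. SUP z\<in>disk. (1 - (cmod z)\<^sup>2) * cmod (deriv f z)"
  have "?S (f - h) \<le> ?S f + ?S h"
  proof (rule cSUP_least)
    fix z :: complex assume z: "z \<in> disk"
    have "(1 - (cmod z)\<^sup>2) * cmod (deriv (f - h) z)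
        \<le> (1 - (cmod z)\<^sup>2) * (cmod (deriv f z) + cmod (deriv h z))"
      unfolding deriv_diff_bloch[OF f h z] using z
      by (intro mult_left_mono norm_triangle_ineq4) (simp add: power_le_one)
    thus "(1 - (cmod z)\<^sup>2) * cmod (deriv (f - h) z) \<le> ?S f + ?S h"
      using bloch_seminorm_upper[OF f z] bloch_seminorm_upper[OF h z]
      by (simp add: distrib_left)
  qed auto
  moreover have "cmod ((f - h) 0) \<le> cmod (f 0) + cmod (h 0)"
    by (simp add: norm_triangle_ineq4)
  ultimately show ?thesis unfolding bloch_norm_def by linarith
qed

lemma bloch_norm_commute:
  assumes f: "f \<in> bloch" and h: "h \<in> bloch"
  shows "bloch_norm (f - h) = bloch_norm (h - f)"
  unfolding bloch_norm_def
  using deriv_diff_bloch[OF f h] deriv_diff_bloch[OF h f]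
  by (auto simp: norm_minus_commute intro!: SUP_cong)

lemma bloch_norm_nonneg: "f \<in> bloch \<Longrightarrow> 0 \<le> bloch_norm f"
  using bloch_seminorm_nonneg[of f] unfolding bloch_norm_def by simp

lemma Metric_space_bloch: "Metric_space bloch (norm_dist bloch bloch_norm)"
proof
  show "0 \<le> norm_dist bloch bloch_norm f h" for f h
    unfolding norm_dist_def by (auto intro: bloch_norm_nonneg bloch_diff)
  show "norm_dist bloch bloch_norm f h = norm_dist bloch bloch_norm h f" for f h
    unfolding norm_dist_def using bloch_norm_commute by auto
  show "norm_dist bloch bloch_norm f h = 0 \<longleftrightarrow> f = h" if f: "f \<in> bloch" and h: "h \<in> bloch" for f h
  proof
    assume "norm_dist bloch bloch_norm f h = 0"
    hence "f - h = (\<lambda>_. 0)"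
      using f h bloch_norm_eq_0[OF bloch_diff[OF f h]] by (simp add: norm_dist_def)
    hence "f z - h z = 0" for z by (metis fun_diff_def)
    thus "f = h" by (simp add: fun_eq_iff)
  next
    assume "f = h"
    thus "norm_dist bloch bloch_norm f h = 0"
      using h by (simp add: norm_dist_def bloch_norm_def deriv_diff_bloch)
  qed
  show "norm_dist bloch bloch_norm f k \<le> norm_dist bloch bloch_norm f h + norm_dist bloch bloch_norm h k"
    if "f \<in> bloch" "h \<in> bloch" "k \<in> bloch" for f h k
  proof -
    have "f - k = (f - h) - (k - h)" by (simp add: fun_eq_iff)
    thus ?thesis
      using bloch_norm_triangle[OF bloch_diff bloch_diff, of f h k h] that
        bloch_norm_commute[of k h] by (simp add: norm_dist_def)
  qed
qed

end

theory Submission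
  imports Defs
begin

text \<open>Write \<open>T\<close> for the commutator and \<open>h = (g \<circ> \<phi>)' - g'\<close>. By the fundamental theorem of calculus
  the derivative of \<open>T f\<close> is \<open>f(\<phi>(z)) h(z)\<close>: the integral operators disappear, and on the level of
  derivatives \<open>T\<close> is a weighted composition operator. The value \<open>(T f)(0)\<close> is an integral of \<open>f g'\<close>
  over the segment from \<open>0\<close> to \<open>\<phi>(0)\<close>, a compact subset of the disk, and so causes no trouble.

  If the weight \<open>(1 - \<bar>z\<bar>\<^sup>2) \<bar>h(z)\<bar>\<close> is bounded, the boundedness of \<open>T\<close> is therefore immediate; conversely,
  the weight is recovered by applying \<open>T\<close> to the constant function \<open>1\<close>.

  For sufficiency in the compact case, Montel's theorem extracts from a bounded sequence in \<open>H\<^sup>\<infinity>\<close> a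
  subsequence that converges locally uniformly. Its image converges in the Bloch norm: where
  \<open>\<bar>\<phi>(z)\<bar> \<le> r\<close>, the convergence is uniform and the weight is bounded, and where \<open>\<bar>\<phi>(z)\<bar> > r\<close> the
  weight itself is small. Hence images of balls are compact.

  For necessity, the monomials \<open>z\<^sup>n\<close> are bounded by \<open>1\<close> and tend to \<open>0\<close> pointwise on the disk, so the
  only possible limit point of \<open>T z\<^sup>n\<close> has derivative \<open>0\<close>. Compactness thus makes
  \<open>(1 - \<bar>z\<bar>\<^sup>2) \<bar>\<phi>(z)\<bar>\<^sup>m \<bar>h(z)\<bar>\<close> uniformly small for some \<open>m\<close>, and
  \<open>\<bar>\<phi>(z)\<bar>\<^sup>m > 1/2\<close> as soon as \<open>\<bar>\<phi>(z)\<bar>\<close> is close to \<open>1\<close>.\<close>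

section \<open>Bounded functions and the Bloch norm\<close>

lemma hinf_holomorphic: "f \<in> hinf \<Longrightarrow> f holomorphic_on disk"
  by (simp add: hinf_def hol_disk_def)

lemma hinf_norm_upper:
  assumes "f \<in> hinf" "z \<in> disk"
  shows "cmod (f z) \<le> hinf_norm f"
proof -
  have "bdd_above ((\<lambda>z. cmod (f z)) ` disk)"
    using assms(1) unfolding hinf_def bounded_iff by (auto simp: bdd_above_def)
  thus ?thesis
    unfolding hinf_norm_def using assms(2) by (intro cSUP_upper)
qed

lemma hinfI:
  assumes "f holomorphic_on disk" "\<And>z. z \<in> disk \<Longrightarrow> cmod (f z) \<le> K"
  shows "(\<lambda>z. if z \<in> disk then f z else 0) \<in> hinf"
proof -
  have "(\<lambda>z. if z \<in> disk then f z else 0) holomorphic_on disk"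
    using assms(1) by (rule holomorphic_transform) auto
  moreover have "bounded ((\<lambda>z. if z \<in> disk then f z else 0) ` disk)"
    unfolding bounded_iff using assms(2) by (intro exI[of _ K]) auto
  ultimately show ?thesis by (simp add: hinf_def hol_disk_def)
qed

lemma hinf_norm_le:
  assumes "\<And>z. z \<in> disk \<Longrightarrow> cmod (f z) \<le> K"
  shows "hinf_norm f \<le> K"
  unfolding hinf_norm_def using assms by (intro cSUP_least) auto

lemma weighted_deriv_le_bloch_norm:
  assumes "f \<in> bloch" "z \<in> disk"
  shows "(1 - (cmod z)\<^sup>2) * cmod (deriv f z) \<le> bloch_norm f"
  using bloch_seminorm_upper[OF assms] unfolding bloch_norm_def by (simp add: add_increasing)

section \<open>The Volterra operator and the derivative of the commutator\<close>

lemma volterra_op_has_derivative: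
  assumes f: "f holomorphic_on disk" and g: "g holomorphic_on disk" and z: "z \<in> disk"
  shows "(volterra_op g f has_field_derivative f z * deriv g z) (at z)"
proof -
  have "(\<lambda>\<zeta>. f \<zeta> * deriv g \<zeta>) holomorphic_on disk"
    using f g by (intro holomorphic_intros) auto
  then obtain P where P: "\<And>x. x \<in> disk \<Longrightarrow> (P has_field_derivative f x * deriv g x) (at x within disk)"
    by (rule holomorphic_convex_primitive'[OF convex_ball open_ball]) blast
  have V: "volterra_op g f w = P w - P 0" if w: "w \<in> disk" for w
  proof -
    have "closed_segment 0 w \<subseteq> disk"
      using w by (intro closed_segment_subset) auto
    then have "((\<lambda>\<zeta>. f \<zeta> * deriv g \<zeta>) has_contour_integral P w - P 0) (linepath 0 w)"
      using contour_integral_primitive[of disk P "\<lambda>\<zeta>. f \<zeta> * deriv g \<zeta>" "linepath 0 w"] P by simp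
    thus ?thesis using w by (simp add: volterra_op_def contour_integral_unique)
  qed
  have "((\<lambda>w. P w - P 0) has_field_derivative f z * deriv g z - 0) (at z)"
    using P[OF z] z by (intro derivative_intros) (simp add: at_within_open[OF z])
  then have "((\<lambda>w. P w - P 0) has_field_derivative f z * deriv g z) (at z)" by simp
  thus ?thesis
    by (rule has_field_derivative_transform_within_open[OF _ open_ball z]) (rule V[symmetric])
qed

lemma volterra_op_diff_bound:
  assumes f: "f holomorphic_on disk" and k: "k holomorphic_on disk"
    and g: "g holomorphic_on disk" and w: "w \<in> disk"
    and e: "\<And>z. z \<in> closed_segment 0 w \<Longrightarrow> cmod (f z - k z) \<le> e"
    and M: "\<And>z. z \<in> closed_segment 0 w \<Longrightarrow> cmod (deriv g z) \<le> M"
  shows "cmod (volterra_op g f w - volterra_op g k w) \<le> e * M"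
proof -
  have seg: "closed_segment 0 w \<subseteq> disk"
    using w by (intro closed_segment_subset) auto
  have int: "(\<lambda>\<zeta>. u \<zeta> * deriv g \<zeta>) contour_integrable_on linepath 0 w"
    if "u holomorphic_on disk" for u
  proof -
    have "(\<lambda>\<zeta>. u \<zeta> * deriv g \<zeta>) holomorphic_on disk"
      using that g by (intro holomorphic_intros) auto
    thus ?thesis
      using seg by (intro contour_integrable_continuous_linepath)
        (meson holomorphic_on_imp_continuous_on continuous_on_subset)
  qed
  have e0: "0 \<le> e" using order_trans[OF norm_ge_zero e[of 0]] by simp
  have M0: "0 \<le> M" using order_trans[OF norm_ge_zero M[of 0]] by simp
  have "((\<lambda>\<zeta>. f \<zeta> * deriv g \<zeta> - k \<zeta> * deriv g \<zeta>) has_contour_integral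
      volterra_op g f w - volterra_op g k w) (linepath 0 w)"
    using int[OF f] int[OF k] w unfolding volterra_op_def
    by (auto intro!: has_contour_integral_diff has_contour_integral_integral)
  moreover have "cmod (f z * deriv g z - k z * deriv g z) \<le> e * M"
    if "z \<in> closed_segment 0 w" for z
    using mult_mono[OF e[OF that] M[OF that] e0 norm_ge_zero]
    by (simp add: left_diff_distrib[symmetric] norm_mult)
  ultimately have "cmod (volterra_op g f w - volterra_op g k w) \<le> e * M * cmod (w - 0)"
    using e0 M0 by (intro has_contour_integral_bound_linepath) auto
  also have "\<dots> \<le> e * M * 1"
    using w e0 M0 by (intro mult_left_mono) auto
  finally show ?thesis by simp
qed

locale disk_symbols =
  fixes \<phi> g :: "complex \<Rightarrow> complex"
  assumes phi_holomorphic: "\<phi> holomorphic_on disk"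
    and phi_disk: "\<phi> ` disk \<subseteq> disk"
    and g_holomorphic: "g holomorphic_on disk"
begin

abbreviation T :: "(complex \<Rightarrow> complex) \<Rightarrow> complex \<Rightarrow> complex" where
  "T \<equiv> commutator_op \<phi> g"

definition weight :: "complex \<Rightarrow> real" where
  "weight z = (1 - (cmod z)\<^sup>2) * cmod (deriv (g \<circ> \<phi>) z - deriv g z)"

lemma phi_in_disk: "z \<in> disk \<Longrightarrow> \<phi> z \<in> disk"
  using phi_disk by blast

lemma weight_ge_0: "z \<in> disk \<Longrightarrow> 0 \<le> weight z"
  by (simp add: weight_def power_le_one)

text \<open>The first term of the commutator has derivative \<open>f(\<phi>(z)) g'(\<phi>(z)) \<phi>'(z)\<close> by the chain rule,
  the second \<open>f(\<phi>(z)) g'(z)\<close>, as its integrand already contains \<open>f \<circ> \<phi>\<close>. The common factor can be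
  taken out.\<close>

lemma commutator_has_derivative:
  assumes f: "f holomorphic_on disk" and z: "z \<in> disk"
  shows "(T f has_field_derivative f (\<phi> z) * (deriv (g \<circ> \<phi>) z - deriv g z)) (at z)"
proof -
  have phi: "(\<phi> has_field_derivative deriv \<phi> z) (at z)"
    using phi_holomorphic z by (intro holomorphic_derivI) auto
  have dg: "(g has_field_derivative deriv g (\<phi> z)) (at (\<phi> z))"
    using g_holomorphic phi_in_disk[OF z] by (intro holomorphic_derivI) auto
  have chain: "deriv (g \<circ> \<phi>) z = deriv g (\<phi> z) * deriv \<phi> z"
    using DERIV_chain[OF dg phi] by (rule DERIV_imp_deriv)
  have fphi: "comp_op \<phi> f holomorphic_on disk"
    using holomorphic_on_compose_gen[OF phi_holomorphic f phi_disk]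
    by (rule holomorphic_transform) (simp add: comp_op_def)
  have "((\<lambda>w. volterra_op g f (\<phi> w) - volterra_op g (comp_op \<phi> f) w) has_field_derivative
      f (\<phi> z) * deriv g (\<phi> z) * deriv \<phi> z - comp_op \<phi> f z * deriv g z) (at z)"
    by (rule DERIV_diff[OF DERIV_chain2[OF
            volterra_op_has_derivative[OF f g_holomorphic phi_in_disk[OF z]] phi]
          volterra_op_has_derivative[OF fphi g_holomorphic z]])
  also have "f (\<phi> z) * deriv g (\<phi> z) * deriv \<phi> z - comp_op \<phi> f z * deriv g z
      = f (\<phi> z) * (deriv (g \<circ> \<phi>) z - deriv g z)"
    using z by (simp add: chain comp_op_def algebra_simps)
  finally show ?thesis
    by (rule has_field_derivative_transform_within_open[OF _ open_ball z])
      (simp add: commutator_op_def comp_op_def)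
qed

lemma deriv_commutator:
  assumes "f \<in> hinf" "z \<in> disk"
  shows "deriv (T f) z = f (\<phi> z) * (deriv (g \<circ> \<phi>) z - deriv g z)"
  using commutator_has_derivative[OF hinf_holomorphic[OF assms(1)] assms(2)]
  by (rule DERIV_imp_deriv)

lemma commutator_hol_disk:
  assumes "f \<in> hinf"
  shows "T f \<in> hol_disk"
proof -
  have "T f holomorphic_on disk"
    using commutator_has_derivative[OF hinf_holomorphic[OF assms]]
    by (auto simp only: holomorphic_on_open[OF open_ball])
  thus ?thesis
    by (simp add: hol_disk_def commutator_op_def comp_op_def volterra_op_def)
qed

lemma weighted_deriv_commutator:
  assumes "f \<in> hinf" "z \<in> disk"
  shows "(1 - (cmod z)\<^sup>2) * cmod (deriv (T f) z) = cmod (f (\<phi> z)) * weight z"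
  using deriv_commutator[OF assms] by (simp add: weight_def norm_mult)

lemma commutator_zero: "T (\<lambda>_. 0) = (\<lambda>_. 0)"
  by (auto simp: commutator_op_def comp_op_def volterra_op_def fun_eq_iff)

section \<open>Boundedness\<close>

lemma commutator_in_bloch:
  assumes f: "f \<in> hinf" and bdd: "bdd_above (weight ` disk)"
  shows "T f \<in> bloch"
proof -
  obtain M where M: "\<And>z. z \<in> disk \<Longrightarrow> weight z \<le> M"
    using bdd unfolding bdd_above_def by blast
  have "(1 - (cmod z)\<^sup>2) * cmod (deriv (T f) z) \<le> hinf_norm f * M" if z: "z \<in> disk" for z
    unfolding weighted_deriv_commutator[OF f z]
    using hinf_norm_upper[OF f phi_in_disk[OF z]] M[OF z] weight_ge_0[OF z]
    by (intro mult_mono) (auto intro: order_trans[OF norm_ge_zero])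
  hence "bdd_above ((\<lambda>z. (1 - (cmod z)\<^sup>2) * cmod (deriv (T f) z)) ` disk)"
    by (intro bdd_aboveI2)
  thus ?thesis using commutator_hol_disk[OF f] by (simp add: bloch_def)
qed

text \<open>The two parts of the Bloch norm are controlled by different data: the value at \<open>0\<close> by the
  distance of the arguments on the segment from \<open>0\<close> to \<open>\<phi>(0)\<close>, the seminorm by the weighted
  distance on the range of \<open>\<phi>\<close>. Keeping \<open>e\<close> and \<open>d\<close> apart is what the compactness proof needs.\<close>

lemma bloch_norm_commutator_diff:
  assumes f: "f \<in> hinf" and k: "k \<in> hinf" and bdd: "bdd_above (weight ` disk)"
    and e: "\<And>z. z \<in> closed_segment 0 (\<phi> 0) \<Longrightarrow> cmod (f z - k z) \<le> e"
    and M: "\<And>z. z \<in> closed_segment 0 (\<phi> 0) \<Longrightarrow> cmod (deriv g z) \<le> M"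
    and d: "\<And>z. z \<in> disk \<Longrightarrow> cmod (f (\<phi> z) - k (\<phi> z)) * weight z \<le> d"
  shows "bloch_norm (T f - T k) \<le> e * M + d"
proof -
  have val: "T u 0 = volterra_op g u (\<phi> 0)" for u
    by (simp add: commutator_op_def comp_op_def volterra_op_def)
  have "cmod ((T f - T k) 0) \<le> e * M"
    using volterra_op_diff_bound[OF hinf_holomorphic[OF f] hinf_holomorphic[OF k]
        g_holomorphic phi_in_disk e M] by (simp add: val)
  moreover have "(SUP z\<in>disk. (1 - (cmod z)\<^sup>2) * cmod (deriv (T f - T k) z)) \<le> d"
  proof (rule cSUP_least)
    fix z :: complex assume z: "z \<in> disk"
    have "deriv (T f - T k) z = (f (\<phi> z) - k (\<phi> z)) * (deriv (g \<circ> \<phi>) z - deriv g z)"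
      using deriv_diff_bloch[OF commutator_in_bloch[OF f bdd] commutator_in_bloch[OF k bdd] z]
      by (simp add: deriv_commutator[OF f z] deriv_commutator[OF k z] left_diff_distrib)
    thus "(1 - (cmod z)\<^sup>2) * cmod (deriv (T f - T k) z) \<le> d"
      using d[OF z] by (simp add: weight_def norm_mult mult.left_commute)
  qed auto
  ultimately show ?thesis unfolding bloch_norm_def by linarith
qed

lemma deriv_g_bounded_on_segment:
  obtains M where "0 \<le> M" "\<And>z. z \<in> closed_segment 0 (\<phi> 0) \<Longrightarrow> cmod (deriv g z) \<le> M"
proof -
  have "closed_segment 0 (\<phi> 0) \<subseteq> disk"
    using phi_in_disk[of 0] by (intro closed_segment_subset) auto
  hence "continuous_on (closed_segment 0 (\<phi> 0)) (deriv g)"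
    using holomorphic_deriv[OF g_holomorphic open_ball]
    by (meson holomorphic_on_imp_continuous_on continuous_on_subset)
  hence "bounded (deriv g ` closed_segment 0 (\<phi> 0))"
    by (intro compact_imp_bounded compact_continuous_image) auto
  thus ?thesis using that unfolding bounded_pos by (metis imageI less_imp_le)
qed

lemma bounded_operator_if_bdd_weight:
  assumes bdd: "bdd_above (weight ` disk)"
  shows "bounded_operator hinf hinf_norm bloch bloch_norm T"
proof -
  obtain M where M: "\<And>z. z \<in> closed_segment 0 (\<phi> 0) \<Longrightarrow> cmod (deriv g z) \<le> M"
    using deriv_g_bounded_on_segment by blast
  obtain W where W: "\<And>z. z \<in> disk \<Longrightarrow> weight z \<le> W"
    using bdd unfolding bdd_above_def by blast
  have seg: "closed_segment 0 (\<phi> 0) \<subseteq> disk"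
    using phi_in_disk[of 0] by (intro closed_segment_subset) auto
  have zero: "(\<lambda>_. 0) \<in> hinf"
    using hinfI[of "\<lambda>_. 0" 0] by simp
  have "bloch_norm (T f) \<le> (M + W) * hinf_norm f" if f: "f \<in> hinf" for f
  proof -
    have "bloch_norm (T f - T (\<lambda>_. 0)) \<le> hinf_norm f * M + hinf_norm f * W"
    proof (rule bloch_norm_commutator_diff[OF f zero bdd _ M])
      show "cmod (f z - 0) \<le> hinf_norm f" if "z \<in> closed_segment 0 (\<phi> 0)" for z
        using that seg hinf_norm_upper[OF f] by auto
      show "cmod (f (\<phi> z) - 0) * weight z \<le> hinf_norm f * W" if z: "z \<in> disk" for z
        using hinf_norm_upper[OF f phi_in_disk[OF z]] W[OF z] weight_ge_0[OF z]
        by (intro mult_mono) (auto intro: order_trans[OF norm_ge_zero])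
    qed
    moreover have "T f - T (\<lambda>_. 0) = T f"
      by (simp add: commutator_zero fun_eq_iff)
    ultimately show ?thesis by (simp add: algebra_simps)
  qed
  thus ?thesis
    unfolding bounded_operator_def using commutator_in_bloch[OF _ bdd] by blast
qed

text \<open>The image of the constant function \<open>1\<close> has derivative \<open>(g \<circ> \<phi>)' - g'\<close>.\<close>

lemma bdd_weight_if_maps_into_bloch:
  assumes "T ` hinf \<subseteq> bloch"
  shows "bdd_above (weight ` disk)"
proof -
  define u :: "complex \<Rightarrow> complex" where "u = (\<lambda>z. if z \<in> disk then 1 else 0)"
  have u: "u \<in> hinf" unfolding u_def by (rule hinfI[where K = 1]) auto
  have "(1 - (cmod z)\<^sup>2) * cmod (deriv (T u) z) = weight z" if z: "z \<in> disk" for z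
    using weighted_deriv_commutator[OF u z] phi_in_disk[OF z] by (simp add: u_def)
  moreover have "bdd_above ((\<lambda>z. (1 - (cmod z)\<^sup>2) * cmod (deriv (T u) z)) ` disk)"
    using assms u by (auto simp: bloch_def)
  ultimately show ?thesis by (metis (no_types, lifting) image_cong)
qed

section \<open>Compactness\<close>

text \<open>This is Montel's theorem, with the addition that the bound on the sequence passes to the limit.\<close>

lemma bounded_sequence_in_hinf_converges_locally_uniformly:
  fixes F :: "nat \<Rightarrow> complex \<Rightarrow> complex"
  assumes F: "\<And>n. F n \<in> hinf" and K: "\<And>n. hinf_norm (F n) \<le> K"
  obtains f r where "f \<in> hinf" "hinf_norm f \<le> K" "strict_mono (r :: nat \<Rightarrow> nat)"
    "\<And>S. compact S \<Longrightarrow> S \<subseteq> disk \<Longrightarrow> uniform_limit S (F \<circ> r) f sequentially"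
proof -
  have bound: "cmod (F n z) \<le> K" if "z \<in> disk" for n z
    using hinf_norm_upper[OF F that] K order_trans by blast
  obtain G r where G: "G holomorphic_on disk" and r: "strict_mono (r :: nat \<Rightarrow> nat)"
    and pointwise: "\<And>z. z \<in> disk \<Longrightarrow> (\<lambda>n. F (r n) z) \<longlonglongrightarrow> G z"
    and uniform: "\<And>S. compact S \<Longrightarrow> S \<subseteq> disk \<Longrightarrow> uniform_limit S (F \<circ> r) G sequentially"
  proof (rule Montel[of disk "range F" F])
    show "\<exists>B. \<forall>h\<in>range F. \<forall>z\<in>S. cmod (h z) \<le> B" if "S \<subseteq> disk" for S
      using bound that by blast
  qed (use F hinf_holomorphic in auto)
  have GK: "cmod (G z) \<le> K" if z: "z \<in> disk" for z
    using tendsto_norm[OF pointwise[OF z]] by (rule LIMSEQ_le_const2) (use bound[OF z] in auto)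
  define f where "f = (\<lambda>z. if z \<in> disk then G z else 0)"
  have "f \<in> hinf" unfolding f_def using G GK by (rule hinfI)
  moreover have "hinf_norm f \<le> K"
    by (rule hinf_norm_le) (simp add: f_def GK)
  moreover have "uniform_limit S (F \<circ> r) f sequentially" if "compact S" "S \<subseteq> disk" for S
    using uniform[OF that] that(2) by (auto simp: f_def subset_iff cong: uniform_limit_cong')
  ultimately show ?thesis using r that by blast
qed

text \<open>The disk splits into \<open>\<bar>\<phi>(z)\<bar> \<le> r\<close>, where the arguments are uniformly close, and
  \<open>\<bar>\<phi>(z)\<bar> > r\<close>, where only the crude bound \<open>2 K\<close> on their distance is available but the weight is
  small.\<close>

lemma commutator_continuous_locally_uniformly:
  fixes F :: "nat \<Rightarrow> complex \<Rightarrow> complex"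
  assumes bdd: "bdd_above (weight ` disk)" and van: "vanishes_at_boundary \<phi> weight"
    and F: "\<And>n. F n \<in> hinf" and K: "\<And>n. hinf_norm (F n) \<le> K"
    and f: "f \<in> hinf" and fK: "hinf_norm f \<le> K"
    and lim: "\<And>S. compact S \<Longrightarrow> S \<subseteq> disk \<Longrightarrow> uniform_limit S F f sequentially"
  shows "(\<lambda>n. bloch_norm (T (F n) - T f)) \<longlonglongrightarrow> 0"
proof (rule LIMSEQ_I)
  fix \<epsilon> :: real assume \<epsilon>: "0 < \<epsilon>"
  obtain M where M0: "0 \<le> M" and M: "\<And>z. z \<in> closed_segment 0 (\<phi> 0) \<Longrightarrow> cmod (deriv g z) \<le> M"
    using deriv_g_bounded_on_segment by blast
  obtain W where W: "\<And>z. z \<in> disk \<Longrightarrow> weight z \<le> W"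
    using bdd unfolding bdd_above_def by blast
  have W0: "0 \<le> W" using weight_ge_0[of 0] W[of 0] by simp
  have K0: "0 \<le> K"
    using order_trans[OF norm_ge_zero hinf_norm_upper[OF f, of 0]] fK by simp
  have "0 < \<epsilon> / (4 * (K + 1))" using \<epsilon> K0 by simp
  then obtain r where r: "0 < r" "r < 1"
    and small: "\<And>z. z \<in> disk \<Longrightarrow> cmod (\<phi> z) > r \<Longrightarrow> \<bar>weight z\<bar> < \<epsilon> / (4 * (K + 1))"
    using van unfolding vanishes_at_boundary_def by metis
  \<comment> \<open>The radius also covers the segment that determines the value at \<open>0\<close>.\<close>
  define R where "R = max r (cmod (\<phi> 0))"
  have R: "cball 0 R \<subseteq> disk"
    using r phi_in_disk[of 0] by (auto simp: R_def)
  have seg: "closed_segment 0 (\<phi> 0) \<subseteq> cball 0 R"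
    using r by (intro closed_segment_subset) (auto simp: R_def)
  define e where "e = \<epsilon> / (4 * (M + W + 1))"
  have e: "0 < e" using \<epsilon> M0 W0 by (simp add: e_def)
  have eMW: "e * (M + W + 1) = \<epsilon> / 4" using M0 W0 by (simp add: e_def field_simps)
  have "e * M \<le> e * (M + W + 1)" "e * W \<le> e * (M + W + 1)"
    using e M0 W0 by (auto intro!: mult_left_mono)
  hence eM: "e * M \<le> \<epsilon> / 4" and eW: "e * W \<le> \<epsilon> / 4" unfolding eMW by auto
  have "\<forall>\<^sub>F n in sequentially. \<forall>z\<in>cball 0 R. dist (F n z) (f z) < e"
    using lim[OF compact_cball R] e by (auto simp: uniform_limit_iff)
  then obtain N where N: "\<And>n z. n \<ge> N \<Longrightarrow> z \<in> cball 0 R \<Longrightarrow> cmod (F n z - f z) \<le> e"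
    unfolding eventually_sequentially dist_norm by (meson less_imp_le)
  have "norm (bloch_norm (T (F n) - T f) - 0) < \<epsilon>" if n: "n \<ge> N" for n
  proof -
    have "bloch_norm (T (F n) - T f) \<le> e * M + \<epsilon> / 2"
    proof (rule bloch_norm_commutator_diff[OF F f bdd _ M])
      show "cmod (F n z - f z) \<le> e" if "z \<in> closed_segment 0 (\<phi> 0)" for z
        using N[OF n] that seg by blast
      show "cmod (F n (\<phi> z) - f (\<phi> z)) * weight z \<le> \<epsilon> / 2" if z: "z \<in> disk" for z
      proof (cases "cmod (\<phi> z) > r")
        case True
        have "cmod (F n (\<phi> z) - f (\<phi> z)) \<le> 2 * K"
          using norm_triangle_ineq4[of "F n (\<phi> z)" "f (\<phi> z)"] K[of n] fK
            hinf_norm_upper[OF F phi_in_disk[OF z], of n] hinf_norm_upper[OF f phi_in_disk[OF z]]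
          by linarith
        hence "cmod (F n (\<phi> z) - f (\<phi> z)) * weight z \<le> (2 * K) * (\<epsilon> / (4 * (K + 1)))"
          using small[OF z True] weight_ge_0[OF z] K0 by (intro mult_mono) auto
        also have "\<dots> \<le> \<epsilon> / 2"
          using K0 \<epsilon> by (simp add: field_simps)
        finally show ?thesis .
      next
        case False
        hence "\<phi> z \<in> cball 0 R" by (simp add: R_def)
        hence "cmod (F n (\<phi> z) - f (\<phi> z)) * weight z \<le> e * W"
          using N[OF n] W[OF z] weight_ge_0[OF z] e by (intro mult_mono) auto
        thus ?thesis using eW \<epsilon> by linarith
      qed
    qed
    moreover have "0 \<le> bloch_norm (T (F n) - T f)"
      by (intro bloch_norm_nonneg bloch_diff commutator_in_bloch F f bdd)
    ultimately show ?thesis using eM \<epsilon> by simp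
  qed
  thus "\<exists>N. \<forall>n\<ge>N. norm (bloch_norm (T (F n) - T f) - 0) < \<epsilon>" by blast
qed

text \<open>The image of the full ball of radius \<open>K\<close> is compact, not just relatively compact, because the
  limit function given by Montel's theorem lies in the same ball. The closure of the image of any
  subset of the ball is then a closed subset of a compact set.\<close>

lemma compact_operator_if_weight_vanishes:
  assumes bdd: "bdd_above (weight ` disk)" and van: "vanishes_at_boundary \<phi> weight"
  shows "compact_operator hinf hinf_norm bloch bloch_norm T"
proof -
  interpret BL: Metric_space bloch "norm_dist bloch bloch_norm" by (rule Metric_space_bloch)
  have into: "T ` hinf \<subseteq> bloch" using commutator_in_bloch[OF _ bdd] by blast
  have "compactin BL.mtopology (BL.mtopology closure_of (T ` A))"
    if A: "A \<subseteq> hinf" and bdd_A: "bdd_above (hinf_norm ` A)" for A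
  proof -
    obtain K where K: "\<And>f. f \<in> A \<Longrightarrow> hinf_norm f \<le> K"
      using bdd_A unfolding bdd_above_def by blast
    define B where "B = {f \<in> hinf. hinf_norm f \<le> K}"
    have compact: "compactin BL.mtopology (T ` B)"
      unfolding BL.compactin_sequentially
    proof (intro conjI allI impI)
      show "T ` B \<subseteq> bloch" using into by (auto simp: B_def)
      fix s :: "nat \<Rightarrow> complex \<Rightarrow> complex" assume "range s \<subseteq> T ` B"
      hence "\<forall>n. \<exists>f. f \<in> B \<and> s n = T f" by blast
      then obtain F where F: "\<And>n. F n \<in> B" and s: "\<And>n. s n = T (F n)" by metis
      obtain f r where f: "f \<in> hinf" "hinf_norm f \<le> K" and r: "strict_mono (r :: nat \<Rightarrow> nat)"
        and lim: "\<And>S. compact S \<Longrightarrow> S \<subseteq> disk \<Longrightarrow> uniform_limit S (F \<circ> r) f sequentially"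
        using bounded_sequence_in_hinf_converges_locally_uniformly[of F K] F
        unfolding B_def by blast
      have "(\<lambda>n. bloch_norm (T ((F \<circ> r) n) - T f)) \<longlonglongrightarrow> 0"
        using F by (intro commutator_continuous_locally_uniformly[OF bdd van _ _ f lim])
          (auto simp: B_def)
      moreover have "T (F n) \<in> bloch" "T f \<in> bloch" for n
        using F f into by (auto simp: B_def)
      ultimately have "limitin BL.mtopology (s \<circ> r) (T f) sequentially"
        by (simp add: BL.limitin_metric_dist_null norm_dist_def s)
      thus "\<exists>l r. l \<in> T ` B \<and> strict_mono r \<and> limitin BL.mtopology (s \<circ> r) l sequentially"
        using f r by (auto simp: B_def)
    qed
    have "T ` A \<subseteq> T ` B" using A K by (auto simp: B_def)
    hence "BL.mtopology closure_of (T ` A) \<subseteq> T ` B"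
      using compactin_imp_closedin[OF BL.Hausdorff_space_mtopology compact]
      by (rule closure_of_minimal)
    thus ?thesis using closed_compactin[OF compact] by simp
  qed
  thus ?thesis using into by (simp add: compact_operator_def norm_topology_def)
qed

text \<open>A limit point \<open>l\<close> of the images of the monomials satisfies \<open>l' = 0\<close>, because
  \<open>\<phi>(z)\<^sup>n \<longlonglongrightarrow> 0\<close> at each point; convergence in norm makes this uniform in \<open>z\<close>.\<close>

lemma weight_times_power_small:
  assumes comp: "compact_operator hinf hinf_norm bloch bloch_norm T" and \<epsilon>: "0 < \<epsilon>"
  obtains m where "\<And>z. z \<in> disk \<Longrightarrow> cmod (\<phi> z) ^ m * weight z < \<epsilon>"
proof -
  interpret BL: Metric_space bloch "norm_dist bloch bloch_norm" by (rule Metric_space_bloch)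
  have into: "T ` hinf \<subseteq> bloch" using comp by (simp add: compact_operator_def)
  define p :: "nat \<Rightarrow> complex \<Rightarrow> complex" where "p n = (\<lambda>z. if z \<in> disk then z ^ n else 0)" for n
  have p: "p n \<in> hinf" for n
    unfolding p_def by (rule hinfI[where K = 1])
      (auto intro!: holomorphic_intros simp: norm_power power_le_one)
  have "hinf_norm (p n) \<le> 1" for n
    by (rule hinf_norm_le) (simp add: p_def norm_power power_le_one)
  hence "bdd_above (hinf_norm ` range p)" by (intro bdd_aboveI[where M = 1]) auto
  moreover have "range p \<subseteq> hinf" using p by blast
  ultimately have "compactin BL.mtopology (BL.mtopology closure_of (T ` range p))"
    using comp by (simp add: compact_operator_def norm_topology_def)
  moreover have "range (\<lambda>n. T (p n)) \<subseteq> BL.mtopology closure_of (T ` range p)"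
    using closure_of_subset[of "T ` range p" BL.mtopology] into p by auto
  ultimately obtain l r where r: "strict_mono (r :: nat \<Rightarrow> nat)"
    and lim: "limitin BL.mtopology ((\<lambda>n. T (p n)) \<circ> r) l sequentially"
    unfolding BL.compactin_sequentially by metis
  have l: "l \<in> bloch" using lim by (simp add: BL.limitin_metric_dist_null)
  have Tp: "T (p n) \<in> bloch" for n using into p by blast
  have norm_lim: "(\<lambda>n. bloch_norm (T (p (r n)) - l)) \<longlonglongrightarrow> 0"
    using lim Tp l by (simp add: BL.limitin_metric_dist_null norm_dist_def)
  have close: "(1 - (cmod z)\<^sup>2) * cmod (deriv (T (p n)) z - deriv l z) \<le> bloch_norm (T (p n) - l)"
    if z: "z \<in> disk" for n z
    using weighted_deriv_le_bloch_norm[OF bloch_diff[OF Tp l] z] deriv_diff_bloch[OF Tp l z]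
    by simp
  have l0: "deriv l z = 0" if z: "z \<in> disk" for z
  proof -
    have "(\<lambda>n. \<phi> z ^ r n) \<longlonglongrightarrow> 0"
      using LIMSEQ_subseq_LIMSEQ[OF LIMSEQ_power_zero r, of "\<phi> z"] phi_in_disk[OF z]
      by (simp add: o_def)
    hence "(\<lambda>n. (1 - (cmod z)\<^sup>2) * cmod (\<phi> z ^ r n * (deriv (g \<circ> \<phi>) z - deriv g z) - deriv l z))
        \<longlonglongrightarrow> (1 - (cmod z)\<^sup>2) * cmod (0 * (deriv (g \<circ> \<phi>) z - deriv g z) - deriv l z)"
      by (intro tendsto_intros)
    hence "(\<lambda>n. (1 - (cmod z)\<^sup>2) * cmod (deriv (T (p (r n))) z - deriv l z))
        \<longlonglongrightarrow> (1 - (cmod z)\<^sup>2) * cmod (deriv l z)"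
      using phi_in_disk[OF z] by (simp add: deriv_commutator[OF p z]) (simp add: p_def)
    hence "(1 - (cmod z)\<^sup>2) * cmod (deriv l z) \<le> 0"
      using norm_lim by (rule LIMSEQ_le) (use close[OF z] in blast)
    moreover have "(cmod z)\<^sup>2 < 1" using z by (simp add: power_less_one_iff)
    ultimately show ?thesis by (simp add: mult_le_0_iff)
  qed
  obtain n where n: "bloch_norm (T (p (r n)) - l) < \<epsilon>"
    using order_tendstoD(2)[OF norm_lim \<epsilon>] by (auto simp: eventually_sequentially)
  show ?thesis
  proof (rule that[of "r n"])
    fix z :: complex assume z: "z \<in> disk"
    have "cmod (\<phi> z) ^ r n * weight z = (1 - (cmod z)\<^sup>2) * cmod (deriv (T (p (r n))) z)"
      using weighted_deriv_commutator[OF p z] phi_in_disk[OF z] by (simp add: p_def norm_power)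
    also have "\<dots> < \<epsilon>" using close[OF z, of "r n"] n by (simp add: l0[OF z])
    finally show "cmod (\<phi> z) ^ r n * weight z < \<epsilon>" .
  qed
qed

lemma weight_vanishes_if_compact:
  assumes comp: "compact_operator hinf hinf_norm bloch bloch_norm T"
  shows "vanishes_at_boundary \<phi> weight"
  unfolding vanishes_at_boundary_def
proof (intro allI impI)
  fix \<epsilon> :: real assume "0 < \<epsilon>"
  then obtain m where m: "\<And>z. z \<in> disk \<Longrightarrow> cmod (\<phi> z) ^ m * weight z < \<epsilon> / 2"
    using weight_times_power_small[OF comp, of "\<epsilon> / 2"] by auto
  \<comment> \<open>Bernoulli's inequality gives \<open>r ^ m \<ge> 1 - m / (2 * (m + 1)) > 1/2\<close>.\<close>
  define r :: real where "r = 1 - 1 / (2 * (real m + 1))"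
  have r: "0 < r" "r < 1" by (auto simp: r_def field_simps)
  have "1 + real m * (- (1 / (2 * (real m + 1)))) \<le> r ^ m"
    using Bernoulli_inequality[of "- (1 / (2 * (real m + 1)))" m] by (simp add: r_def field_simps)
  moreover have "1 / 2 < 1 + real m * (- (1 / (2 * (real m + 1))))" by (simp add: field_simps)
  ultimately have half: "1 / 2 < r ^ m" by linarith
  have "\<bar>weight z\<bar> < \<epsilon>" if z: "z \<in> disk" and "cmod (\<phi> z) > r" for z
  proof -
    have "r ^ m \<le> cmod (\<phi> z) ^ m" using that r by (intro power_mono) auto
    hence "1 / 2 * weight z \<le> cmod (\<phi> z) ^ m * weight z"
      using half weight_ge_0[OF z] by (intro mult_right_mono) auto
    thus ?thesis using m[OF z] weight_ge_0[OF z] by simp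
  qed
  thus "\<exists>r>0. r < 1 \<and> (\<forall>z\<in>disk. r < cmod (\<phi> z) \<longrightarrow> \<bar>weight z\<bar> < \<epsilon>)" using r by blast
qed

end

section \<open>The characterisation\<close>

theorem theorem4p1:
  fixes \<phi> g :: "complex \<Rightarrow> complex"
  assumes "\<phi> holomorphic_on disk" and "\<phi> ` disk \<subseteq> disk"
    and "g holomorphic_on disk"
  shows "(bounded_operator hinf hinf_norm bloch bloch_norm (commutator_op \<phi> g)
            \<longleftrightarrow> bdd_above ((\<lambda>z. (1 - (cmod z)\<^sup>2) * cmod (deriv (g \<circ> \<phi>) z - deriv g z)) ` disk))
       \<and> (compact_operator hinf hinf_norm bloch bloch_norm (commutator_op \<phi> g)
            \<longleftrightarrow> bdd_above ((\<lambda>z. (1 - (cmod z)\<^sup>2) * cmod (deriv (g \<circ> \<phi>) z - deriv g z)) ` disk)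
              \<and> vanishes_at_boundary \<phi>
                  (\<lambda>z. (1 - (cmod z)\<^sup>2) * cmod (deriv (g \<circ> \<phi>) z - deriv g z)))"
proof -
  interpret disk_symbols \<phi> g by unfold_locales (fact assms)+
  have weight: "(\<lambda>z. (1 - (cmod z)\<^sup>2) * cmod (deriv (g \<circ> \<phi>) z - deriv g z)) = weight"
    by (simp add: weight_def fun_eq_iff)
  show ?thesis
    unfolding weight
  proof (intro conjI iffI)
    assume "bounded_operator hinf hinf_norm bloch bloch_norm T"
    hence "T ` hinf \<subseteq> bloch" by (simp add: bounded_operator_def)
    thus "bdd_above (weight ` disk)" by (rule bdd_weight_if_maps_into_bloch)
  next
    assume "bdd_above (weight ` disk)"
    thus "bounded_operator hinf hinf_norm bloch bloch_norm T"
      by (rule bounded_operator_if_bdd_weight)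
  next
    assume "compact_operator hinf hinf_norm bloch bloch_norm T"
    hence "T ` hinf \<subseteq> bloch" by (simp add: compact_operator_def)
    thus "bdd_above (weight ` disk)" by (rule bdd_weight_if_maps_into_bloch)
  next
    assume "compact_operator hinf hinf_norm bloch bloch_norm T"
    thus "vanishes_at_boundary \<phi> weight" by (rule weight_vanishes_if_compact)
  next
    assume "bdd_above (weight ` disk) \<and> vanishes_at_boundary \<phi> weight"
    thus "compact_operator hinf hinf_norm bloch bloch_norm T"
      by (intro compact_operator_if_weight_vanishes) auto
  qed
qed

end
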